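(* Let $\#(n)$ be the number of different blocks of length $n$ allowed in the $T_2$-shift. Let $(F_n)_{n\ge 1}$ be the Lamé numbers, with $F_1=2$, $F_2=3$, $F_3=4$ and $F_n=F_{n-1}+F_{n-3}$ for $n\ge 4$. Then $\#(n)=F_n$ for every integer $n\ge 1$, and the recursive relationship $\#(n)=\#(n-1)+\#(n-3)$ holds for every $n\ge 4$.
   Context: For a finite alphabet $\mathcal{A}$, the full shift $\mathcal{A}^{\mathbb{Z}}$ is the set of all bi-infinite sequences $(x_i)_{i\in\mathbb{Z}}$ with $x_i\in\mathcal{A}$. A block of length $n$ is a finite sequence of $n$ consecutive symbols. Given a set $\mathcal{F}$ of forbidden blocks, the associated shift space $X$ is the set of all bi-infinite sequences containing no block of $\mathcal{F}$. An allowed block of length $n$ is one that occurs in some sequence of $X$. The $T_2$-shift is the shift space over $\mathcal{A}=\{0,1\}$ with $\mathcal{F}=\{011,101,110,111\}$; equivalently, any two occurrences of the symbol $1$ are separated by at least two $0$'s. *)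

theory Defs
  imports Main
begin

definition full_shift :: "'a set \<Rightarrow> (int \<Rightarrow> 'a) set" where
  "full_shift A = {x. \<forall>i. x i \<in> A}"

definition occurs_in :: "'a list \<Rightarrow> (int \<Rightarrow> 'a) \<Rightarrow> bool" where
  "occurs_in w x \<longleftrightarrow> (\<exists>i. \<forall>k<length w. x (i + int k) = w ! k)"

definition shift_space :: "'a set \<Rightarrow> 'a list set \<Rightarrow> (int \<Rightarrow> 'a) set" where
  "shift_space A F = {x \<in> full_shift A. \<forall>w\<in>F. \<not> occurs_in w x}"

definition allowed_blocks :: "(int \<Rightarrow> 'a) set \<Rightarrow> nat \<Rightarrow> 'a list set" where
  "allowed_blocks X n = {w. length w = n \<and> (\<exists>x\<in>X. occurs_in w x)}"

definition T2_shift :: "(int \<Rightarrow> nat) set" where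
  "T2_shift = shift_space {0, 1} {[0, 1, 1], [1, 0, 1], [1, 1, 0], [1, 1, 1]}"

definition num_blocks :: "nat \<Rightarrow> nat" where
  "num_blocks n = card (allowed_blocks T2_shift n)"

(* The sequence is indexed from 1; the value at 0 is a dummy used by no other equation. *)
fun lame :: "nat \<Rightarrow> nat" where
  "lame 0 = 0"
| "lame (Suc 0) = 2"
| "lame (Suc (Suc 0)) = 3"
| "lame (Suc (Suc (Suc 0))) = 4"
| "lame (Suc (Suc (Suc (Suc n)))) = lame (Suc (Suc (Suc n))) + lame (Suc n)"

end

theory Submission
  imports Defs
begin

text \<open>
  A binary word is allowed iff any two of its ones are at distance at least 3: such a word extends
  to a point of the shift by zeros on both sides. A word of this kind of length \<open>n + 3\<close>
  is either \<open>0\<close> followed by one of length \<open>n + 2\<close>, or \<open>100\<close> followed by one of length \<open>n\<close>.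
\<close>

text \<open>Over a binary alphabet, excluding \<open>110\<close> and \<open>111\<close> puts a 0
  right after each 1, and excluding \<open>101\<close> and \<open>111\<close> puts a 0 two places
  after it.\<close>

lemma T2_shift_iff:
  "x \<in> T2_shift \<longleftrightarrow> (\<forall>i. x i \<in> {0, 1} \<and> (x i = 1 \<longrightarrow> x (i + 1) = 0 \<and> x (i + 2) = 0))"
  (is "_ \<longleftrightarrow> ?R")
proof -
  have occ3: "occurs_in [a, b, c] x \<longleftrightarrow> (\<exists>i. x i = a \<and> x (i + 1) = b \<and> x (i + 2) = c)" for a b c
    by (simp add: occurs_in_def All_less_Suc numeral_3_eq_3 numeral_2_eq_2 ac_simps)
  show ?thesis
  proof
    assume x: "x \<in> T2_shift"
    show ?R
    proof
      fix i
      have "x j = 0 \<or> x j = 1" for j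
        using x by (simp add: T2_shift_def shift_space_def full_shift_def)
      from this[of i] this[of "i + 1"] this[of "i + 2"]
      show "x i \<in> {0, 1} \<and> (x i = 1 \<longrightarrow> x (i + 1) = 0 \<and> x (i + 2) = 0)"
        using x by (auto simp: T2_shift_def shift_space_def occ3)
    qed
  next
    assume R: ?R
    have "x i = 1 \<Longrightarrow> x (i + 1) = 0" "x i = 1 \<Longrightarrow> x (i + 2) = 0" for i
      using R by auto
    \<comment> \<open>The block \<open>011\<close> starts with 0, so it is refuted by the condition
      at its second position.\<close>
    moreover have "x (i + 1) = 1 \<Longrightarrow> x (i + 2) = 0" for i
      using R[rule_format, of "i + 1"] by (simp add: ac_simps)
    ultimately show "x \<in> T2_shift"
      using R by (fastforce simp: T2_shift_def shift_space_def full_shift_def occ3)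
  qed
qed

text \<open>Ranging over pairs \<open>i\<close>, \<open>j\<close> lets the single bound
  \<open>j < length w\<close> also handle a 1 with fewer than two symbols to its right.\<close>

definition sparse :: "nat list \<Rightarrow> bool" where
  "sparse w \<longleftrightarrow> (\<forall>i<length w. w ! i \<in> {0, 1}) \<and>
    (\<forall>i j. i < j \<longrightarrow> j < i + 3 \<longrightarrow> j < length w \<longrightarrow> w ! i = 1 \<longrightarrow> w ! j = 0)"

lemma allowed_blocks_T2_shift:
  "allowed_blocks T2_shift n = {w. length w = n \<and> sparse w}"
proof (intro set_eqI iffI)
  fix w assume "w \<in> allowed_blocks T2_shift n"
  then obtain x i where len: "length w = n" and x: "x \<in> T2_shift"
    and w: "\<And>k. k < n \<Longrightarrow> x (i + int k) = w ! k"
    by (auto simp: allowed_blocks_def occurs_in_def)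
  have "w ! l = 0" if "k < l" "l < k + 3" "l < n" "w ! k = 1" for k l
  proof -
    have "x (i + int k) = 1" using that w[of k] by simp
    then have "x (i + int k + 1) = 0" "x (i + int k + 2) = 0"
      using x by (auto simp: T2_shift_iff)
    moreover have "l = k + 1 \<or> l = k + 2" using that by linarith
    ultimately show ?thesis using w[of l] that by (auto simp: ac_simps)
  qed
  moreover have "w ! k \<in> {0, 1}" if "k < n" for k
    using x by (simp add: T2_shift_iff flip: w[OF that])
  ultimately show "w \<in> {w. length w = n \<and> sparse w}"
    using len by (simp add: sparse_def)
next
  fix w assume "w \<in> {w. length w = n \<and> sparse w}"
  then have len: "length w = n" and w: "sparse w" by auto
  define x where "x i = (if 0 \<le> i \<and> i < int n then w ! nat i else 0)" for i
  have "x i \<in> {0, 1}" for i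
    using w len nat_less_iff[of i n] by (auto simp: x_def sparse_def)
  \<comment> \<open>The padding is 0, so a 1 at \<open>i\<close> comes from \<open>w\<close>, whence
    \<open>0 \<le> i\<close>. If \<open>j\<close> lies beyond the right end of \<open>w\<close>, the
    padding itself gives \<open>x j = 0\<close>.\<close>
  moreover have "x j = 0" if "x i = 1" "i < j" "j < i + 3" for i j
  proof (cases "j < int n")
    case True
    have "0 \<le> i" "w ! nat i = 1" using that by (auto simp: x_def split: if_splits)
    moreover have "nat i < nat j" "nat j < nat i + 3" "nat j < length w"
      using that True \<open>0 \<le> i\<close> len by auto
    ultimately have "w ! nat j = 0" using w unfolding sparse_def by blast
    then show ?thesis by (simp add: x_def)
  qed (simp add: x_def)
  ultimately have "x \<in> T2_shift" by (auto simp: T2_shift_iff)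
  moreover have "occurs_in w x"
    unfolding occurs_in_def using len by (intro exI[of _ 0]) (simp add: x_def)
  ultimately show "w \<in> allowed_blocks T2_shift n"
    using len by (auto simp: allowed_blocks_def)
qed

lemma sparse_Nil: "sparse []"
  by (simp add: sparse_def)

text \<open>Prepending shifts indices by one: a leading 1 constrains positions 1 and 2 of
  \<open>a # w\<close>, which are 0 and 1 of \<open>w\<close>; hence the bound 2 here against 3 in
  \<open>sparse\<close>.\<close>

lemma sparse_Cons:
  "sparse (a # w) \<longleftrightarrow> a \<in> {0, 1} \<and> sparse w \<and> (a = 1 \<longrightarrow> (\<forall>j<2. j < length w \<longrightarrow> w ! j = 0))"
  (is "?L \<longleftrightarrow> ?R")
proof
  assume L: ?L
  then have bin: "\<And>i. i < Suc (length w) \<Longrightarrow> (a # w) ! i \<in> {0, 1}"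
    and gap: "\<And>i j. i < j \<Longrightarrow> j < i + 3 \<Longrightarrow> j < Suc (length w) \<Longrightarrow>
      (a # w) ! i = 1 \<Longrightarrow> (a # w) ! j = 0"
    by (auto simp: sparse_def)
  have "w ! i \<in> {0, 1}" if "i < length w" for i using bin[of "Suc i"] that by simp
  moreover have "w ! j = 0" if "i < j" "j < i + 3" "j < length w" "w ! i = 1" for i j
    using gap[of "Suc i" "Suc j"] that by simp
  moreover have "w ! j = 0" if "j < 2" "j < length w" "a = 1" for j
    using gap[of 0 "Suc j"] that by simp
  ultimately show ?R using bin[of 0] by (simp add: sparse_def)
next
  assume R: ?R
  have "(a # w) ! i \<in> {0, 1}" if "i < Suc (length w)" for i
    using R that by (cases i) (auto simp: sparse_def)
  moreover have "(a # w) ! j = 0"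
    if "i < j" "j < i + 3" "j < Suc (length w)" "(a # w) ! i = 1" for i j
    using R that by (cases i; cases j) (auto simp: sparse_def)
  ultimately show ?L by (simp add: sparse_def)
qed

lemmas sparse_simps = sparse_Nil sparse_Cons numeral_2_eq_2 All_less_Suc

text \<open>Length at least 3 leaves room for both zeros forced by a leading 1; the remaining
  \<open>n\<close> symbols are then out of its reach. A leading 0 constrains nothing.\<close>

lemma sparse_words_rec:
  "{w. length w = n + 3 \<and> sparse w} =
    (\<lambda>w. 0 # w) ` {w. length w = n + 2 \<and> sparse w} \<union>
    (\<lambda>w. 1 # 0 # 0 # w) ` {w. length w = n \<and> sparse w}"
  by (auto simp: sparse_simps numeral_3_eq_3 length_Suc_conv image_iff)

lemma finite_allowed_blocks_T2_shift: "finite (allowed_blocks T2_shift n)"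
proof (rule finite_subset)
  show "allowed_blocks T2_shift n \<subseteq> {w. set w \<subseteq> {0, 1} \<and> length w = n}"
    by (fastforce simp: allowed_blocks_T2_shift sparse_def in_set_conv_nth)
qed (simp add: finite_lists_length_eq)

lemma num_blocks_rec: "num_blocks (n + 3) = num_blocks (n + 2) + num_blocks n"
proof -
  let ?A = "\<lambda>n. {w. length w = n \<and> sparse w}"
  have "finite (?A n)" for n
    using finite_allowed_blocks_T2_shift[of n] by (simp add: allowed_blocks_T2_shift)
  then have "card (?A (n + 3)) = card ((\<lambda>w. 0 # w) ` ?A (n + 2)) +
      card ((\<lambda>w. 1 # 0 # 0 # w) ` ?A n)"
    \<comment> \<open>The two images are disjoint because their words differ in the first
      symbol.\<close>
    unfolding sparse_words_rec by (intro card_Un_disjoint) auto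
  then show ?thesis
    by (simp add: num_blocks_def allowed_blocks_T2_shift card_image inj_on_def)
qed

text \<open>The empty word counts once; this starts the recurrence one step early and yields the
  third Lame number as 3 + 1.\<close>

lemma num_blocks_0: "num_blocks 0 = 1"
proof -
  have "{w. length w = 0 \<and> sparse w} = {[]}" by (auto simp: sparse_simps)
  then show ?thesis by (simp add: num_blocks_def allowed_blocks_T2_shift)
qed

lemma num_blocks_1: "num_blocks 1 = 2"
proof -
  have "{w. length w = 1 \<and> sparse w} = {[0], [1]}"
    by (auto simp: sparse_simps length_Suc_conv)
  then show ?thesis by (simp add: num_blocks_def allowed_blocks_T2_shift)
qed

lemma num_blocks_2: "num_blocks 2 = 3"
proof -
  have "{w. length w = 2 \<and> sparse w} = {[0, 0], [0, 1], [1, 0]}"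
    by (auto simp: sparse_simps length_Suc_conv)
  then show ?thesis by (simp add: num_blocks_def allowed_blocks_T2_shift)
qed

text \<open>Stated at \<open>Suc n\<close> since the sequences differ at 0, where
  \<open>num_blocks\<close> is 1 and \<open>lame\<close> has its dummy value 0.\<close>

lemma num_blocks_eq_lame: "num_blocks (Suc n) = lame (Suc n)"
proof (induction "Suc n" arbitrary: n rule: lame.induct)
  case 2
  then show ?case using num_blocks_1 by simp
next
  case 3
  then show ?case using num_blocks_2 by (simp add: numeral_2_eq_2)
next
  case 4
  then show ?case
    using num_blocks_rec[of 0] num_blocks_0 num_blocks_2
    by (simp add: numeral_3_eq_3 numeral_2_eq_2)
next
  case (5 m)
  then show ?case
    \<comment> \<open>At \<open>Suc m\<close> the recurrence has the shape of the last equation of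
      \<open>lame\<close>, and both smaller arguments are positive, so the induction hypotheses
      apply.\<close>
    using num_blocks_rec[of "Suc m"] by (simp add: numeral_3_eq_3 numeral_2_eq_2)
qed

theorem lemma2:
  shows "(\<forall>n\<ge>1. num_blocks n = lame n) \<and>
    (\<forall>n\<ge>4. num_blocks n = num_blocks (n - 1) + num_blocks (n - 3))"
proof (intro conjI allI impI)
  fix n :: nat assume "1 \<le> n"
  then show "num_blocks n = lame n"
    using num_blocks_eq_lame[of "n - 1"] by simp
next
  fix n :: nat assume "4 \<le> n"
  \<comment> \<open>Subtraction on \<open>nat\<close> truncates at 0; the lower bound on
    \<open>n\<close> makes these identities exact.\<close>
  moreover from this have "n - 3 + 3 = n" "n - 3 + 2 = n - 1" by auto
  ultimately show "num_blocks n = num_blocks (n - 1) + num_blocks (n - 3)"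
    using num_blocks_rec[of "n - 3"] by simp
qed

end
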